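(* Let $L$ be a $\sigma$-quantum logic, let $p:L\times L\to[0,1]$ be an s-map on $L$ with $\nu(a):=p(a,a)$, and let $\mathcal{O}$ be the set of all discrete observables on $L$. Let $x,y\in\mathcal{O}$ be such that the sums defining $\nu(x)$, $\nu(y)$, $p(x,y)$, $p(y,x)$, $p(x,x)$, $p(y,y)$ converge absolutely. Then there exist probability spaces $(\Omega_i,\mathcal{S}_i,P_i)$, $i=1,2$, and random variables $\xi_i,\eta_i:\Omega_i\to\mathbb{R}$, $i=1,2$, which are $\mathcal{S}_i$-measurable, such that: (a) $c(x,y)=\mathrm{cov}(\xi_1,\eta_1)$ and $c(y,x)=\mathrm{cov}(\eta_2,\xi_2)$; (b) $E_i(\xi_i)=\nu(x)$ and $E_i(\eta_i)=\nu(y)$ for $i=1,2$, where $E_i$ denotes expectation with respect to $P_i$; (c) $(c(x,y))^2\le c(x,x)\,c(y,y)$.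
   Context: A quantum logic is a lattice $(L,\le,\vee,\wedge)$ with least element $0$ and greatest element $1$ and a map $\perp:L\to L$ such that $(a^\perp)^\perp=a$; $a\vee a^\perp=1$; $a\le b$ implies $b^\perp\le a^\perp$; and $a\le b$ implies $b=a\vee(a^\perp\wedge b)$ (an orthomodular lattice). It is a $\sigma$-quantum logic if all countable suprema and infima exist. Elements $a,b\in L$ are orthogonal ($a\perp b$) if $a\le b^\perp$. An s-map on $L$ is a map $p:L\times L\to[0,1]$ such that: (s1) $p(1,1)=1$; (s2) if $a\perp b$ then $p(a,b)=0$; (s3) if $a\perp b$ then for every $c\in L$, $p(a\vee b,c)=p(a,c)+p(b,c)$ and $p(c,a\vee b)=p(c,a)+p(c,b)$. Put $\nu(a)=p(a,a)$ for $a\in L$. An observable on $L$ is a $\sigma$-homomorphism $x:\mathcal{B}(\mathbb{R})\to L$ from the Borel $\sigma$-algebra, i.e. $x(\mathbb{R})=1$, $x(\mathbb{R}\setminus E)=x(E)^\perp$, and $x(\bigcup_n E_n)=\bigvee_n x(E_n)$ for countable families of Borel sets. Its spectrum is $\sigma(x)=\bigcap\{E\in\mathcal{B}(\mathbb{R}) : x(E)=1\}$. The observable $x$ is discrete if $\sigma(x)$ is countable (finite or countably infinite). For discrete observables $x,y$ (whenever the sums exist): $\nu(x)=\sum_{t\in\sigma(x)}t\,\nu(x(\{t\}))$, $p(x,y)=\sum_{s\in\sigma(x)}\sum_{t\in\sigma(y)}s\,t\,p(x(\{s\}),y(\{t\}))$ (the first joint moment), and $c(x,y)=p(x,y)-\nu(x)\nu(y)$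 (the covariance; in general $c(x,y)\neq c(y,x)$). $\mathrm{cov}$ denotes the usual covariance of random variables on a probability space. *)

theory Defs
  imports
    "HOL-Probability.Probability"
    "HOL-Library.Complemented_Lattices"
    "HOL-Library.Countable_Complete_Lattices"
begin

text \<open>The orthocomplement of \<open>a\<close> is \<open>- a\<close>. The operations \<open>Sup\<close> and \<open>Inf\<close> are only required to be
  suprema and infima on countable sets.\<close>

class sigma_quantum_logic = orthomodular_lattice + countable_complete_lattice

definition orthogonal_elems :: "'a::orthomodular_lattice \<Rightarrow> 'a \<Rightarrow> bool" where
  "orthogonal_elems a b \<longleftrightarrow> a \<le> - b"

definition s_map :: "('a::orthomodular_lattice \<Rightarrow> 'a \<Rightarrow> real) \<Rightarrow> bool" where
  "s_map p \<longleftrightarrow>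
     (\<forall>a b. p a b \<in> {0..1}) \<and>
     p top top = 1 \<and>
     (\<forall>a b. orthogonal_elems a b \<longrightarrow> p a b = 0) \<and>
     (\<forall>a b c. orthogonal_elems a b \<longrightarrow>
        p (sup a b) c = p a c + p b c \<and> p c (sup a b) = p c a + p c b)"

definition s_state :: "('a \<Rightarrow> 'a \<Rightarrow> real) \<Rightarrow> 'a \<Rightarrow> real" where
  "s_state p a = p a a"

text \<open>Observables are total functions; only their values on Borel sets matter.\<close>

definition observable :: "(real set \<Rightarrow> 'a::sigma_quantum_logic) \<Rightarrow> bool" where
  "observable x \<longleftrightarrow>
     x UNIV = top \<and>
     (\<forall>E\<in>sets borel. x (- E) = - x E) \<and>
     (\<forall>E::nat \<Rightarrow> real set. range E \<subseteq> sets borel \<longrightarrow> x (\<Union>n. E n) = (SUP n. x (E n)))"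

text \<open>The intersection ranges over all Borel sets, not only over closed ones.\<close>

definition spectrum :: "(real set \<Rightarrow> 'a::sigma_quantum_logic) \<Rightarrow> real set" where
  "spectrum x = \<Inter>{E \<in> sets borel. x E = top}"

definition discrete_observable :: "(real set \<Rightarrow> 'a::sigma_quantum_logic) \<Rightarrow> bool" where
  "discrete_observable x \<longleftrightarrow> observable x \<and> countable (spectrum x)"

definition obs_mean_converges ::
  "('a::sigma_quantum_logic \<Rightarrow> 'a \<Rightarrow> real) \<Rightarrow> (real set \<Rightarrow> 'a) \<Rightarrow> bool" where
  "obs_mean_converges p x \<longleftrightarrow> (\<lambda>t. \<bar>t * s_state p (x {t})\<bar>) summable_on spectrum x"

definition obs_mean ::
  "('a::sigma_quantum_logic \<Rightarrow> 'a \<Rightarrow> real) \<Rightarrow> (real set \<Rightarrow> 'a) \<Rightarrow> real" where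
  "obs_mean p x = (\<Sum>\<^sub>\<infinity>t\<in>spectrum x. t * s_state p (x {t}))"

definition joint_moment_converges ::
  "('a::sigma_quantum_logic \<Rightarrow> 'a \<Rightarrow> real) \<Rightarrow> (real set \<Rightarrow> 'a) \<Rightarrow> (real set \<Rightarrow> 'a) \<Rightarrow> bool" where
  "joint_moment_converges p x y \<longleftrightarrow>
     (\<lambda>(s, t). \<bar>s * t * p (x {s}) (y {t})\<bar>) summable_on (spectrum x \<times> spectrum y)"

definition joint_moment ::
  "('a::sigma_quantum_logic \<Rightarrow> 'a \<Rightarrow> real) \<Rightarrow> (real set \<Rightarrow> 'a) \<Rightarrow> (real set \<Rightarrow> 'a) \<Rightarrow> real" where
  "joint_moment p x y =
     (\<Sum>\<^sub>\<infinity>s\<in>spectrum x. \<Sum>\<^sub>\<infinity>t\<in>spectrum y. s * t * p (x {s}) (y {t}))"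

definition obs_cov ::
  "('a::sigma_quantum_logic \<Rightarrow> 'a \<Rightarrow> real) \<Rightarrow> (real set \<Rightarrow> 'a) \<Rightarrow> (real set \<Rightarrow> 'a) \<Rightarrow> real" where
  "obs_cov p x y = joint_moment p x y - obs_mean p x * obs_mean p y"

definition rv_cov :: "'w measure \<Rightarrow> ('w \<Rightarrow> real) \<Rightarrow> ('w \<Rightarrow> real) \<Rightarrow> real" where
  "rv_cov M X Y =
     (\<integral>w. (X w - integral\<^sup>L M X) * (Y w - integral\<^sup>L M Y) \<partial>M)"

text \<open>The Bochner integral of a non-integrable function is 0, so the existence of the covariance
  has to be expressed separately.\<close>

definition rv_cov_exists :: "'w measure \<Rightarrow> ('w \<Rightarrow> real) \<Rightarrow> ('w \<Rightarrow> real) \<Rightarrow> bool" where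
  "rv_cov_exists M X Y \<longleftrightarrow>
     integrable M X \<and> integrable M Y \<and> integrable M (\<lambda>w. X w * Y w)"

end

theory Submission
  imports Defs
begin

text \<open>
  For discrete observables the numbers \<open>p (x {s}) (y {t})\<close> with \<open>s, t \<noteq> 0\<close> are the joint weights of a
  pair of random variables. As an s-map is only finitely additive, these weights need not add up to
  \<open>1\<close>, and summing them over one argument may give less than \<open>\<nu> (x {s})\<close> or \<open>\<nu> (y {t})\<close>. The missing
  mass can be placed on the two coordinate axes so that the marginals become exactly \<open>\<nu> (x {s})\<close> and
  \<open>\<nu> (y {t})\<close> away from \<open>0\<close>; what is left for the origin is nonnegative because of
  \<open>\<nu> a + \<nu> b - p a b \<le> 1\<close>. The axes do not contribute to any joint moment \<open>s t p (x {s}) (y {t})\<close>, so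
  the two coordinates have the required means and covariance. Since distinct atoms of \<open>x\<close> are
  orthogonal, the joint moment of \<open>x\<close> with itself is the second moment of the first coordinate, and likewise for \<open>y\<close>; the
  inequality is then the Cauchy-Schwarz inequality for the two coordinates.
\<close>

section \<open>Observables on finite sets and elementary properties of s-maps\<close>

lemma observable_Un:
  assumes "observable x" "A \<in> sets borel" "B \<in> sets borel"
  shows "x (A \<union> B) = sup (x A) (x B)"
proof -
  define E where "E n = (if n = 0 then A else B)" for n :: nat
  have R: "(\<lambda>n. x (E n)) ` UNIV = {x A, x B}"
    by (auto simp: E_def image_iff intro: exI[of _ 1] exI[of _ 0])
  have "range E \<subseteq> sets borel"
    using assms by (auto simp: E_def)
  then have "x (\<Union>n. E n) = (SUP n. x (E n))"
    using assms(1) by (simp add: observable_def)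
  moreover have "(\<Union>n. E n) = A \<union> B"
    by (auto simp: E_def split: if_splits)
  ultimately show ?thesis
    by (simp add: R)
qed

lemma observable_mono:
  assumes "observable x" "A \<in> sets borel" "B \<in> sets borel" "A \<subseteq> B"
  shows "x A \<le> x B"
  by (metis assms observable_Un sup.cobounded1 sup.absorb2)

lemma observable_compl:
  assumes "observable x" "A \<in> sets borel"
  shows "x (- A) = - x A"
  using assms by (simp add: observable_def)

lemma observable_empty:
  assumes "observable x"
  shows "x {} = bot"
  using observable_compl[OF assms, of UNIV] assms by (simp add: observable_def)

lemma observable_disjoint:
  assumes "observable x" "A \<in> sets borel" "B \<in> sets borel" "A \<inter> B = {}"
  shows "orthogonal_elems (x A) (x B)"
  unfolding orthogonal_elems_def
  using observable_mono[OF assms(1,2), of "- B"] observable_compl[OF assms(1,3)] assms(3,4)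
  by (simp add: disjoint_eq_subset_Compl)

lemma
  assumes "s_map p"
  shows s_map_nonneg: "0 \<le> p a b"
    and s_map_top_top: "p top top = 1"
    and s_map_orth: "orthogonal_elems a b \<Longrightarrow> p a b = 0"
    and s_map_sup_left: "orthogonal_elems a b \<Longrightarrow> p (sup a b) c = p a c + p b c"
    and s_map_sup_right: "orthogonal_elems a b \<Longrightarrow> p c (sup a b) = p c a + p c b"
  using assms by (auto simp: s_map_def)

lemma orthogonal_compl: "orthogonal_elems a (- a)" "orthogonal_elems (- a) a"
  by (auto simp: orthogonal_elems_def)

lemma s_map_compl:
  assumes "s_map p"
  shows "p a c + p (- a) c = p top c" "p c a + p c (- a) = p c top"
  using s_map_sup_left[OF assms orthogonal_compl(1)] s_map_sup_right[OF assms orthogonal_compl(1)]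
  by (metis sup_compl_top)+

text \<open>Splitting the argument \<open>top\<close> into \<open>a\<close> and \<open>- a\<close>
  leaves only the diagonal term, because \<open>a\<close> and \<open>- a\<close> are
  orthogonal.\<close>

lemma s_map_top:
  assumes "s_map p"
  shows "p a top = s_state p a" "p top a = s_state p a"
  using s_map_compl[OF assms, of a a] s_map_orth[OF assms] orthogonal_compl[of a]
  by (auto simp: s_state_def)

lemma s_map_le_state:
  assumes "s_map p"
  shows "p a b \<le> s_state p a" "p a b \<le> s_state p b"
  using s_map_compl(1)[OF assms, of a b] s_map_compl(2)[OF assms, of a b]
    s_map_nonneg[OF assms, of a "- b"] s_map_nonneg[OF assms, of "- a" b]
  by (auto simp: s_map_top[OF assms])

text \<open>Additivity turns \<open>p (- a) b\<close> into \<open>s_state p b - p a b\<close> and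
  \<open>p (- a) top\<close> into \<open>1 - s_state p a\<close>, and the former is at most the
  latter. No compatibility of \<open>a\<close> and \<open>b\<close> enters.\<close>

lemma s_map_inclusion_exclusion:
  assumes "s_map p"
  shows "s_state p a + s_state p b - p a b \<le> 1"
proof -
  have "p (- a) b \<le> p (- a) top"
    using s_map_le_state(1)[OF assms] s_map_top[OF assms] by metis
  then show ?thesis
    using s_map_compl(1)[OF assms, of a b] s_map_compl(1)[OF assms, of a top] s_map_top_top[OF assms]
    by (simp add: s_map_top[OF assms])
qed

lemma s_map_bot:
  assumes "s_map p"
  shows "p bot c = 0" "p c bot = 0"
  using s_map_orth[OF assms] by (auto simp: orthogonal_elems_def)

text \<open>Disjoint Borel sets have orthogonal values, so (s3) applies each time a point is added.
  Only finite sets are within its reach.\<close>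

lemma s_map_observable_sum_left:
  assumes "s_map p" "observable x" "finite F"
  shows "p (x F) c = (\<Sum>s\<in>F. p (x {s}) c)"
  using assms(3)
proof (induction F rule: finite_induct)
  case empty
  then show ?case
    using assms by (simp add: observable_empty s_map_bot)
next
  case (insert s F)
  have B: "F \<in> sets borel"
    using insert by (simp add: finite_imp_closed)
  have "x (insert s F) = sup (x {s}) (x F)"
    using observable_Un[OF assms(2) _ B, of "{s}"] by simp
  then show ?case
    using insert s_map_sup_left[OF assms(1) observable_disjoint[OF assms(2) _ B, of "{s}"]] by simp
qed

lemma s_map_observable_sum_right:
  assumes "s_map p" "observable x" "finite F"
  shows "p c (x F) = (\<Sum>s\<in>F. p c (x {s}))"
proof -
  \<comment> \<open>The axioms are symmetric under exchanging the two arguments although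
    \<open>p\<close> itself need not be.\<close>
  have "s_map (\<lambda>a b. p b a)"
    using assms(1) by (auto simp: s_map_def orthogonal_elems_def) (metis ortho_involution orthogonal_elems_def compl_le_swap1)+
  from s_map_observable_sum_left[OF this assms(2,3)] show ?thesis .
qed

lemma s_state_observable_sum:
  assumes "s_map p" "observable x" "finite F"
  shows "s_state p (x F) = (\<Sum>s\<in>F. s_state p (x {s}))"
  using s_map_observable_sum_left[OF assms, of top] by (simp add: s_map_top[OF assms(1)])

text \<open>Some Borel set of value \<open>top\<close> misses \<open>s\<close>, so
  \<open>{s}\<close> lies in a set of value \<open>bot\<close>. Hence sums over the spectrum can be
  read as sums over all reals.\<close>

lemma observable_not_in_spectrum:
  assumes "observable x" "s \<notin> spectrum x"
  shows "x {s} = bot"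
proof -
  obtain E where E: "E \<in> sets borel" "x E = top" "s \<notin> E"
    using assms by (auto simp: spectrum_def)
  have "x {s} \<le> x (- E)"
    using E by (intro observable_mono[OF assms(1)]) auto
  then show ?thesis
    using E observable_compl[OF assms(1) E(1)] by (simp add: bot_unique)
qed

section \<open>Expectations and covariances of random variables\<close>

text \<open>Links the series over spectra with Bochner integrals. Only the products
  \<open>pmf P z * f z\<close> are prescribed, so the mass of \<open>P\<close> at the zeros of
  \<open>f\<close> is left free.\<close>

lemma pmf_expectation_infsum:
  fixes f :: "'b \<Rightarrow> real"
  assumes "(\<lambda>z. \<bar>g z\<bar>) summable_on A"
    and "\<And>z. z \<in> A \<Longrightarrow> pmf P z * f z = g z"
    and "\<And>z. z \<notin> A \<Longrightarrow> pmf P z * f z = 0"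
  shows "integrable (measure_pmf P) f"
    and "measure_pmf.expectation P f = infsum g A"
proof -
  have "(\<lambda>z. norm (pmf P z * f z)) summable_on UNIV"
    using assms by (subst summable_on_cong_neutral[where T = A and g = "\<lambda>z. \<bar>g z\<bar>"]) auto
  then have *: "Infinite_Set_Sum.abs_summable_on (\<lambda>z. pmf P z * f z) UNIV"
    by (simp flip: abs_summable_equivalent)
  then have "integrable (count_space UNIV) (\<lambda>z. pmf P z *\<^sub>R f z)"
    by (simp add: Infinite_Set_Sum.abs_summable_on_def)
  then show "integrable (measure_pmf P) f"
    unfolding measure_pmf_eq_density by (subst integrable_density) auto
  have "measure_pmf.expectation P f = infsum (\<lambda>z. pmf P z * f z) UNIV"
    using infsetsum_infsum[OF *] by (simp add: pmf_expectation_eq_infsetsum)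
  also have "\<dots> = infsum g A"
    using assms by (intro infsum_cong_neutral) auto
  finally show "measure_pmf.expectation P f = infsum g A" .
qed

lemma prob_pmf_infsum:
  "measure_pmf.prob P A = infsum (pmf P) A"
  using pmf_abs_summable[of P A]
  by (simp add: measure_pmf_conv_infsetsum infsetsum_infsum)

lemma rv_cov_eq:
  assumes "prob_space M" "rv_cov_exists M X Y"
  shows "rv_cov M X Y = (\<integral>w. X w * Y w \<partial>M) - integral\<^sup>L M X * integral\<^sup>L M Y"
proof -
  interpret prob_space M by fact
  have [simp]: "integrable M X" "integrable M Y" "integrable M (\<lambda>w. X w * Y w)"
    using assms by (auto simp: rv_cov_exists_def)
  have "rv_cov M X Y = (\<integral>w. X w * Y w - expectation Y * X w - expectation X * Y w
      + expectation X * expectation Y \<partial>M)"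
    unfolding rv_cov_def by (intro Bochner_Integration.integral_cong) (auto simp: algebra_simps)
  then show ?thesis
    by (simp add: prob_space)
qed

text \<open>The second moment of \<open>U + t V\<close>, with \<open>U\<close> and \<open>V\<close>
  the centred variables, is a quadratic polynomial in \<open>t\<close> without negative
  values.\<close>

lemma rv_cov_Cauchy_Schwarz:
  assumes "prob_space M" "rv_cov_exists M X Y" "rv_cov_exists M X X" "rv_cov_exists M Y Y"
  shows "(rv_cov M X Y)\<^sup>2 \<le> rv_cov M X X * rv_cov M Y Y"
proof -
  interpret prob_space M by fact
  have [simp]: "integrable M X" "integrable M Y" "integrable M (\<lambda>w. X w * Y w)"
    "integrable M (\<lambda>w. X w * X w)" "integrable M (\<lambda>w. Y w * Y w)"
    using assms by (auto simp: rv_cov_exists_def)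
  define U where "U w = X w - expectation X" for w
  define V where "V w = Y w - expectation Y" for w
  have [simp]: "integrable M (\<lambda>w. U w * V w)" "integrable M (\<lambda>w. U w * U w)"
    "integrable M (\<lambda>w. V w * V w)"
    by (simp_all add: U_def V_def algebra_simps)
  have eq: "rv_cov M X Y = expectation (\<lambda>w. U w * V w)" "rv_cov M X X = expectation (\<lambda>w. U w * U w)"
    "rv_cov M Y Y = expectation (\<lambda>w. V w * V w)"
    by (simp_all add: rv_cov_def U_def V_def)
  have nonneg: "0 \<le> rv_cov M Y Y * t\<^sup>2 + 2 * rv_cov M X Y * t + rv_cov M X X" for t
  proof -
    have "0 \<le> expectation (\<lambda>w. (U w + t * V w)\<^sup>2)"
      by simp
    also have "\<dots> = expectation (\<lambda>w. U w * U w + 2 * t * (U w * V w) + t\<^sup>2 * (V w * V w))"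
      by (intro Bochner_Integration.integral_cong) (auto simp: algebra_simps power2_eq_square)
    also have "\<dots> = rv_cov M X X + 2 * t * rv_cov M X Y + t\<^sup>2 * rv_cov M Y Y"
      by (simp add: eq)
    finally show ?thesis
      by (simp add: algebra_simps)
  qed
  show ?thesis
  proof (cases "rv_cov M Y Y = 0")
    case True
    have "rv_cov M X Y = 0"
    proof (rule ccontr)
      assume "rv_cov M X Y \<noteq> 0"
      then show False
        \<comment> \<open>The polynomial is now linear in \<open>t\<close>, and this
          \<open>t\<close> gives it the value \<open>-1\<close>.\<close>
        using nonneg[of "- (rv_cov M X X + 1) / (2 * rv_cov M X Y)"] True by (simp add: field_simps)
    qed
    then show ?thesis
      using True by simp
  next
    case False
    then have pos: "rv_cov M Y Y > 0"
      using eq(3) by (simp add: order_less_le)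
    show ?thesis
      \<comment> \<open>This \<open>t\<close> is the minimum point of the quadratic.\<close>
      using nonneg[of "- rv_cov M X Y / rv_cov M Y Y"] pos
      by (simp add: field_simps power2_eq_square)
  qed
qed

section \<open>Completing partial joint weights to a probability distribution\<close>

text \<open>The points \<open>a\<close> and \<open>b\<close> outside \<open>S\<close> and
  \<open>T\<close> receive the missing mass. The hypotheses concern finite partial sums, which is
  what finite additivity delivers; nonnegativity carries the bounds over to infinite sums.\<close>

lemma coupling_pmf_exists:
  fixes q :: "'b \<Rightarrow> 'c \<Rightarrow> real"
  assumes ab: "a \<notin> S" "b \<notin> T"
    and nonneg: "\<And>s t. s \<in> S \<Longrightarrow> t \<in> T \<Longrightarrow> 0 \<le> q s t"
    and row: "\<And>s G. s \<in> S \<Longrightarrow> finite G \<Longrightarrow> G \<subseteq> T \<Longrightarrow> (\<Sum>t\<in>G. q s t) \<le> u s"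
    and col: "\<And>t F. t \<in> T \<Longrightarrow> finite F \<Longrightarrow> F \<subseteq> S \<Longrightarrow> (\<Sum>s\<in>F. q s t) \<le> v t"
    and total: "\<And>F G. finite F \<Longrightarrow> F \<subseteq> S \<Longrightarrow> finite G \<Longrightarrow> G \<subseteq> T \<Longrightarrow>
      sum u F + sum v G - (\<Sum>s\<in>F. \<Sum>t\<in>G. q s t) \<le> 1"
  obtains P where "\<And>s t. s \<in> S \<Longrightarrow> t \<in> T \<Longrightarrow> pmf P (s, t) = q s t"
    and "\<And>s. s \<in> S \<Longrightarrow> pmf (map_pmf fst P) s = u s"
    and "\<And>t. t \<in> T \<Longrightarrow> pmf (map_pmf snd P) t = v t"
proof -
  have u0: "0 \<le> u s" if "s \<in> S" for s
    using row[OF that, of "{}"] by simp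
  have v0: "0 \<le> v t" if "t \<in> T" for t
    using col[OF that, of "{}"] by simp
  \<comment> \<open>With one of the two finite sets empty, \<open>total\<close> bounds the partial
    sums by \<open>1\<close>.\<close>
  have sum_u: "u summable_on S"
    using total[of _ "{}"] u0 by (intro nonneg_bdd_above_summable_on) (auto intro!: bdd_aboveI[of _ 1])
  have sum_v: "v summable_on T"
    using total[of "{}"] v0 by (intro nonneg_bdd_above_summable_on) (auto intro!: bdd_aboveI[of _ 1])
  have sum_row: "q s summable_on T" if "s \<in> S" for s
    using row[OF that] nonneg that
    by (intro nonneg_bdd_above_summable_on) (auto intro!: bdd_aboveI[of _ "u s"])
  have sum_col: "(\<lambda>s. q s t) summable_on S" if "t \<in> T" for t
    using col[OF that] nonneg that
    by (intro nonneg_bdd_above_summable_on) (auto intro!: bdd_aboveI[of _ "v t"])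
  \<comment> \<open>The mass that \<open>q\<close> really puts on each row and column;
    \<open>u s - r s\<close> and \<open>v t - c t\<close> are the deficits to be filled.\<close>
  define r where "r s = infsum (q s) T" for s
  define c where "c t = infsum (\<lambda>s. q s t) S" for t
  have r: "0 \<le> r s" "r s \<le> u s" if "s \<in> S" for s
    using row sum_row nonneg that unfolding r_def
    by (auto intro!: infsum_nonneg infsum_le_finite_sums)
  have c: "0 \<le> c t" "c t \<le> v t" if "t \<in> T" for t
    using col sum_col nonneg that unfolding c_def
    by (auto intro!: infsum_nonneg infsum_le_finite_sums)
  have sum_r: "r summable_on S"
    using summable_on_comparison_test[OF sum_u] r by auto
  have q_row: "((\<lambda>t. q s t) has_sum r s) T" if "s \<in> S" for s
    using sum_row[OF that] by (simp add: r_def)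
  have q_col: "((\<lambda>s. q s t) has_sum c t) S" if "t \<in> T" for t
    using sum_col[OF that] by (simp add: c_def)
  have sum_q: "(\<lambda>(s, t). q s t) summable_on S \<times> T"
    using q_row sum_r nonneg by (intro summable_on_SigmaI[where g = r]) auto
  define U V Q where "U = infsum u S" and "V = infsum v T" and "Q = infsum (\<lambda>(s, t). q s t) (S \<times> T)"
  have U: "(u has_sum U) S" and V: "(v has_sum V) T" and Q: "((\<lambda>(s, t). q s t) has_sum Q) (S \<times> T)"
    using sum_u sum_v sum_q by (simp_all add: U_def V_def Q_def)
  have R: "(r has_sum Q) S"
    using has_sum_SigmaD[OF Q, of r] q_row by simp
  have C: "(c has_sum Q) T"
  proof -
    have "((\<lambda>(t, s). q s t) has_sum Q) (T \<times> S)"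
      using Q by (subst has_sum_swap) (simp add: case_prod_unfold)
    from has_sum_SigmaD[OF this, of c] show ?thesis
      using q_col by simp
  qed
  \<comment> \<open>The finite double sum is first replaced by its upper bound \<open>Q\<close>;
    then suprema over \<open>F\<close> and over \<open>G\<close> can be taken one after the
    other.\<close>
  have UVQ: "U + V - Q \<le> 1"
  proof -
    have "sum u F + sum v G \<le> 1 + Q" if "finite F" "F \<subseteq> S" "finite G" "G \<subseteq> T" for F G
    proof -
      have "(\<Sum>s\<in>F. \<Sum>t\<in>G. q s t) = sum (\<lambda>(s, t). q s t) (F \<times> G)"
        by (simp add: sum.cartesian_product)
      also have "\<dots> \<le> Q"
        unfolding Q_def using that nonneg by (intro finite_sum_le_infsum sum_q) auto
      finally show ?thesis
        using total[OF that] by simp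
    qed
    then have "U \<le> 1 + Q - sum v G" if "finite G" "G \<subseteq> T" for G
      unfolding U_def using that by (intro infsum_le_finite_sums sum_u) (simp add: algebra_simps)
    then have "V \<le> 1 + Q - U"
      unfolding V_def by (intro infsum_le_finite_sums sum_v) (simp add: algebra_simps)
    then show ?thesis
      by simp
  qed
  \<comment> \<open>Row deficits go to the line \<open>t = b\<close>, column deficits to the line
    \<open>s = a\<close>, and the corner \<open>(a, b)\<close> gets what brings the total mass to
    \<open>1\<close>.\<close>
  define w where "w = (\<lambda>(s, t).
    if s \<in> S then if t \<in> T then q s t else if t = b then u s - r s else 0
    else if s = a then if t \<in> T then v t - c t else if t = b then 1 - (U + V - Q) else 0
    else 0)"
  have w0: "0 \<le> w z" for z
    using nonneg r c UVQ by (auto simp: w_def split: prod.split)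
  have w_row: "((\<lambda>t. w (s, t)) has_sum u s) UNIV" if "s \<in> S" for s
  proof -
    have "((\<lambda>t. w (s, t)) has_sum r s) T"
      using q_row[OF that] by (rule has_sum_cong[THEN iffD1, rotated]) (simp add: w_def that)
    moreover have "((\<lambda>t. w (s, t)) has_sum w (s, b)) {b}"
      by (rule has_sum_finiteI) auto
    ultimately have "((\<lambda>t. w (s, t)) has_sum (r s + w (s, b))) (T \<union> {b})"
      using ab by (intro has_sum_Un_disjoint) auto
    moreover have "r s + w (s, b) = u s"
      using ab that by (simp add: w_def)
    ultimately show ?thesis
      using that by (subst has_sum_cong_neutral[where T = "T \<union> {b}" and g = "\<lambda>t. w (s, t)"])
        (auto simp: w_def)
  qed
  have w_col: "((\<lambda>s. w (s, t)) has_sum v t) UNIV" if "t \<in> T" for t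
  proof -
    have "((\<lambda>s. w (s, t)) has_sum c t) S"
      using q_col[OF that] by (rule has_sum_cong[THEN iffD1, rotated]) (simp add: w_def that)
    moreover have "((\<lambda>s. w (s, t)) has_sum w (a, t)) {a}"
      by (rule has_sum_finiteI) auto
    ultimately have "((\<lambda>s. w (s, t)) has_sum (c t + w (a, t))) (S \<union> {a})"
      using ab by (intro has_sum_Un_disjoint) auto
    moreover have "c t + w (a, t) = v t"
      using ab that by (simp add: w_def)
    ultimately show ?thesis
      using that by (subst has_sum_cong_neutral[where T = "S \<union> {a}" and g = "\<lambda>s. w (s, t)"])
        (auto simp: w_def)
  qed
  \<comment> \<open>The column deficits add up to \<open>V - Q\<close>, and the corner supplies the
    rest.\<close>
  have w_row_a: "((\<lambda>t. w (a, t)) has_sum (1 - U)) UNIV"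
  proof -
    have "((\<lambda>t. v t - c t) has_sum (V - Q)) T"
      using has_sum_add[OF V, of "\<lambda>t. - c t" "- Q"] C by (simp add: has_sum_uminus)
    then have "((\<lambda>t. w (a, t)) has_sum (V - Q)) T"
      by (rule has_sum_cong[THEN iffD1, rotated]) (simp add: w_def ab)
    moreover have "((\<lambda>t. w (a, t)) has_sum w (a, b)) {b}"
      by (rule has_sum_finiteI) auto
    ultimately have "((\<lambda>t. w (a, t)) has_sum (V - Q + w (a, b))) (T \<union> {b})"
      using ab by (intro has_sum_Un_disjoint) auto
    moreover have "V - Q + w (a, b) = 1 - U"
      using ab by (simp add: w_def)
    ultimately show ?thesis
      using ab by (subst has_sum_cong_neutral[where T = "T \<union> {b}" and g = "\<lambda>t. w (a, t)"])
        (auto simp: w_def)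
  qed
  \<comment> \<open>The first marginal of \<open>w\<close>; summing it gives the total mass row by
    row.\<close>
  define w1 where "w1 s = (if s \<in> S then u s else if s = a then 1 - U else 0)" for s
  have w_w1: "((\<lambda>t. w (s, t)) has_sum w1 s) UNIV" for s
  proof -
    consider "s \<in> S" | "s = a" | "s \<notin> S" "s \<noteq> a" by blast
    then show ?thesis
      using w_row w_row_a ab by cases (auto simp: w1_def w_def)
  qed
  have w1: "(w1 has_sum 1) UNIV"
  proof -
    have "(w1 has_sum U) S"
      using U by (rule has_sum_cong[THEN iffD1, rotated]) (simp add: w1_def)
    moreover have "(w1 has_sum (1 - U)) {a}"
      using ab by (intro has_sum_finiteI) (auto simp: w1_def)
    ultimately have "(w1 has_sum (U + (1 - U))) (S \<union> {a})"
      using ab by (intro has_sum_Un_disjoint) auto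
    then show ?thesis
      by (subst has_sum_cong_neutral[where T = "S \<union> {a}" and g = w1]) (auto simp: w1_def)
  qed
  have "w summable_on UNIV \<times> UNIV"
    using w_w1 w1 w0 by (intro summable_on_SigmaI[where g = w1]) (auto simp: summable_on_def)
  then have w_sum: "(w has_sum 1) UNIV"
    using has_sum_SigmaI[of UNIV w "\<lambda>_. UNIV" w1 1] w_w1 w1 by simp
  have "(\<integral>\<^sup>+z. ennreal (w z) \<partial>count_space UNIV) = 1"
  proof -
    have *: "Infinite_Set_Sum.abs_summable_on w UNIV"
      using w_sum w0 by (auto simp: summable_on_def simp flip: abs_summable_equivalent)
    have "(\<integral>\<^sup>+z. ennreal (w z) \<partial>count_space UNIV) = ennreal (infsetsum w UNIV)"
      using w0 by (intro nn_integral_conv_infsetsum *)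
    also have "infsetsum w UNIV = 1"
      using w_sum infsetsum_infsum[OF *] by (simp add: infsumI)
    finally show ?thesis
      by simp
  qed
  then have pmf: "pmf (embed_pmf w) z = w z" for z
    by (intro pmf_embed_pmf w0)
  let ?P = "embed_pmf w"
  show thesis
  proof (rule that[of ?P])
    show "pmf ?P (s, t) = q s t" if "s \<in> S" "t \<in> T" for s t
      unfolding pmf using that by (simp add: w_def)
    show "pmf (map_pmf fst ?P) s = u s" if "s \<in> S" for s
    proof -
      have "pmf (map_pmf fst ?P) s = infsum w (Pair s ` UNIV)"
        by (simp add: pmf_map prob_pmf_infsum pmf[abs_def]) (auto intro!: arg_cong[of _ _ "infsum w"])
      also have "\<dots> = infsum (\<lambda>t. w (s, t)) UNIV"
        by (subst infsum_reindex) (auto simp: inj_on_def o_def)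
      finally show ?thesis
        using w_row[OF that] by (simp add: infsumI)
    qed
    show "pmf (map_pmf snd ?P) t = v t" if "t \<in> T" for t
    proof -
      have "pmf (map_pmf snd ?P) t = infsum w ((\<lambda>s. (s, t)) ` UNIV)"
        by (simp add: pmf_map prob_pmf_infsum pmf[abs_def]) (auto intro!: arg_cong[of _ _ "infsum w"])
      also have "\<dots> = infsum (\<lambda>s. w (s, t)) UNIV"
        by (subst infsum_reindex) (auto simp: inj_on_def o_def)
      finally show ?thesis
        using w_col[OF that] by (simp add: infsumI)
    qed
  qed
qed

section \<open>The joint distribution attached to two observables\<close>

text \<open>The coupling with \<open>a = b = 0\<close>. Nothing is claimed at \<open>0\<close>,
  where the marginals of \<open>P\<close> may exceed \<open>s_state p (x {0})\<close> and
  \<open>s_state p (y {0})\<close>; moments do not see this excess.\<close>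

lemma s_map_joint_pmf_exists:
  assumes p: "s_map p" and x: "observable x" and y: "observable y"
  obtains P where "\<And>s t. s \<noteq> 0 \<Longrightarrow> t \<noteq> 0 \<Longrightarrow> pmf P (s, t) = p (x {s}) (y {t})"
    and "\<And>s. s \<noteq> 0 \<Longrightarrow> pmf (map_pmf fst P) s = s_state p (x {s})"
    and "\<And>t. t \<noteq> 0 \<Longrightarrow> pmf (map_pmf snd P) t = s_state p (y {t})"
proof -
  \<comment> \<open>An uncountable index set is harmless: partial sums bounded by \<open>1\<close>
    leave only countably many nonzero weights.\<close>
  let ?S = "- {0 :: real}"
  obtain P where "\<And>s t. s \<in> ?S \<Longrightarrow> t \<in> ?S \<Longrightarrow> pmf P (s, t) = p (x {s}) (y {t})"
    and "\<And>s. s \<in> ?S \<Longrightarrow> pmf (map_pmf fst P) s = s_state p (x {s})"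
    and "\<And>t. t \<in> ?S \<Longrightarrow> pmf (map_pmf snd P) t = s_state p (y {t})"
  proof (rule coupling_pmf_exists[of 0 ?S 0 ?S "\<lambda>s t. p (x {s}) (y {t})"
        "\<lambda>s. s_state p (x {s})" "\<lambda>t. s_state p (y {t})"])
    show "(\<Sum>t\<in>G. p (x {s}) (y {t})) \<le> s_state p (x {s})" if "finite G" for s G
      using s_map_le_state(1)[OF p] by (simp flip: s_map_observable_sum_right[OF p y that])
    show "(\<Sum>s\<in>F. p (x {s}) (y {t})) \<le> s_state p (y {t})" if "finite F" for t F
      using s_map_le_state(2)[OF p] by (simp flip: s_map_observable_sum_left[OF p x that])
    show "(\<Sum>s\<in>F. s_state p (x {s})) + (\<Sum>t\<in>G. s_state p (y {t}))
        - (\<Sum>s\<in>F. \<Sum>t\<in>G. p (x {s}) (y {t})) \<le> 1" if "finite F" "finite G" for F G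
    proof -
      \<comment> \<open>The finite sums collapse, so the total bound becomes an inequality for the
        two elements \<open>x F\<close> and \<open>y G\<close>.\<close>
      have "(\<Sum>s\<in>F. \<Sum>t\<in>G. p (x {s}) (y {t})) = p (x F) (y G)"
        unfolding s_map_observable_sum_left[OF p x that(1)]
        by (simp only: s_map_observable_sum_right[OF p y that(2)])
      then show ?thesis
        using s_map_inclusion_exclusion[OF p, of "x F" "y G"]
        by (simp add: s_state_observable_sum[OF p x that(1)] s_state_observable_sum[OF p y that(2)])
    qed
  qed (auto simp: s_map_nonneg[OF p])
  then show thesis
    by (intro that[of P]) auto
qed

section \<open>Moments of observables as expectations\<close>

lemma s_state_bot:
  assumes "s_map p"
  shows "s_state p bot = 0"
  using s_map_bot(1)[OF assms] by (simp add: s_state_def)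

lemma obs_mean_expectation:
  assumes "s_map p" "observable x" "obs_mean_converges p x"
    and "\<And>s. s \<noteq> 0 \<Longrightarrow> pmf (map_pmf f P) s = s_state p (x {s})"
  shows "integrable (measure_pmf P) f" "measure_pmf.expectation P f = obs_mean p x"
proof -
  have *: "pmf (map_pmf f P) s * s = s * s_state p (x {s})" for s
    using assms(4) by (cases "s = 0") auto
  have 0: "s * s_state p (x {s}) = 0" if "s \<notin> spectrum x" for s
    using observable_not_in_spectrum[OF assms(2) that] s_state_bot[OF assms(1)] by simp
  have conv: "(\<lambda>s. \<bar>s * s_state p (x {s})\<bar>) summable_on spectrum x"
    using assms(3) by (simp add: obs_mean_converges_def)
  show "integrable (measure_pmf P) f"
    using pmf_expectation_infsum(1)[OF conv, of "map_pmf f P" "\<lambda>s. s"] * 0 by simp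
  show "measure_pmf.expectation P f = obs_mean p x"
    using pmf_expectation_infsum(2)[OF conv, of "map_pmf f P" "\<lambda>s. s"] * 0
    by (simp add: obs_mean_def)
qed

text \<open>The product of the coordinates vanishes on both axes, so the prescribed weights off the
  axes determine the expectation.\<close>

lemma joint_moment_expectation:
  assumes "s_map p" "observable x" "observable y" "joint_moment_converges p x y"
    and "\<And>s t. s \<noteq> 0 \<Longrightarrow> t \<noteq> 0 \<Longrightarrow> pmf P (s, t) = p (x {s}) (y {t})"
  shows "integrable (measure_pmf P) (\<lambda>z. fst z * snd z)"
    and "measure_pmf.expectation P (\<lambda>z. fst z * snd z) = joint_moment p x y"
proof -
  let ?g = "\<lambda>(s, t). s * t * p (x {s}) (y {t})"
  have *: "pmf P z * (fst z * snd z) = ?g z" for z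
    using assms(5)[of "fst z" "snd z"] by (cases z; cases "fst z = 0 \<or> snd z = 0") auto
  have 0: "?g z = 0" if "z \<notin> spectrum x \<times> spectrum y" for z
    using observable_not_in_spectrum[OF assms(2)] observable_not_in_spectrum[OF assms(3)]
      s_map_bot[OF assms(1)] that by (cases z) auto
  then have **: "pmf P z * (fst z * snd z) = 0" if "z \<notin> spectrum x \<times> spectrum y" for z
    using that by (simp only: *)
  have conv: "(\<lambda>z. \<bar>?g z\<bar>) summable_on spectrum x \<times> spectrum y"
    using assms(4) by (simp add: joint_moment_converges_def case_prod_unfold)
  show "integrable (measure_pmf P) (\<lambda>z. fst z * snd z)"
    by (rule pmf_expectation_infsum(1)[where g = ?g, OF conv]) (rule *, erule **)
  have "measure_pmf.expectation P (\<lambda>z. fst z * snd z) = infsum ?g (spectrum x \<times> spectrum y)"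
    by (rule pmf_expectation_infsum(2)[where g = ?g, OF conv]) (rule *, erule **)
  also have "\<dots> = joint_moment p x y"
  proof -
    \<comment> \<open>Summability over the product justifies passing to the iterated sum that
      defines \<open>joint_moment\<close>.\<close>
    have "?g summable_on spectrum x \<times> spectrum y"
      by (rule abs_summable_summable) (simp only: real_norm_def conv)
    then show ?thesis
      unfolding joint_moment_def by (rule infsum_Sigma'_banach[symmetric])
  qed
  finally show "measure_pmf.expectation P (\<lambda>z. fst z * snd z) = joint_moment p x y" .
qed

text \<open>Orthogonality of distinct atoms leaves only the diagonal, so the marginal law of
  \<open>f\<close> suffices. Hence a distribution built for the pair \<open>x\<close>,
  \<open>y\<close> also yields \<open>joint_moment p x x\<close>.\<close>

lemma second_moment_expectation:
  assumes p: "s_map p" and x: "observable x" and conv: "joint_moment_converges p x x"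
    and P: "\<And>s. s \<noteq> 0 \<Longrightarrow> pmf (map_pmf f P) s = s_state p (x {s})"
  shows "integrable (measure_pmf P) (\<lambda>z. f z * f z)"
    and "measure_pmf.expectation P (\<lambda>z. f z * f z) = joint_moment p x x"
proof -
  let ?g = "\<lambda>s. s * s * s_state p (x {s})"
  have *: "pmf (map_pmf f P) s * (s * s) = ?g s" for s
    using P by (cases "s = 0") auto
  have 0: "?g s = 0" if "s \<notin> spectrum x" for s
    using observable_not_in_spectrum[OF x that] s_state_bot[OF p] by simp
  have diag: "(\<lambda>s. \<bar>?g s\<bar>) summable_on spectrum x"
  proof -
    \<comment> \<open>Absolute convergence is inherited by the diagonal.\<close>
    have "(\<lambda>(s, t). \<bar>s * t * p (x {s}) (x {t})\<bar>) summable_on (\<lambda>s. (s, s)) ` spectrum x"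
      using conv unfolding joint_moment_converges_def by (rule summable_on_subset) auto
    then show ?thesis
      by (subst (asm) summable_on_reindex) (auto simp: inj_on_def o_def s_state_def)
  qed
  have "(\<Sum>\<^sub>\<infinity>t\<in>spectrum x. s * t * p (x {s}) (x {t})) = ?g s" if "s \<in> spectrum x" for s
  proof -
    have "p (x {s}) (x {t}) = 0" if "t \<noteq> s" for t
      using that by (intro s_map_orth[OF p] observable_disjoint[OF x]) auto
    then have "(\<Sum>\<^sub>\<infinity>t\<in>spectrum x. s * t * p (x {s}) (x {t}))
        = (\<Sum>\<^sub>\<infinity>t\<in>{s}. s * t * p (x {s}) (x {t}))"
      using that by (intro infsum_cong_neutral) auto
    then show ?thesis
      by (simp add: s_state_def)
  qed
  then have "joint_moment p x x = infsum ?g (spectrum x)"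
    unfolding joint_moment_def by (rule infsum_cong)
  then show "measure_pmf.expectation P (\<lambda>z. f z * f z) = joint_moment p x x"
    using pmf_expectation_infsum(2)[OF diag, of "map_pmf f P" "\<lambda>s. s * s"] * 0 by simp
  show "integrable (measure_pmf P) (\<lambda>z. f z * f z)"
    using pmf_expectation_infsum(1)[OF diag, of "map_pmf f P" "\<lambda>s. s * s"] * 0 by simp
qed

text \<open>A single \<open>P\<close> carries all three covariances in the inequality, which is why
  Cauchy-Schwarz applies to them.\<close>

lemma s_map_covariance_representation:
  assumes p: "s_map p" and x: "observable x" and y: "observable y"
    and mean: "obs_mean_converges p x" "obs_mean_converges p y"
    and xy: "joint_moment_converges p x y"
    and sq: "joint_moment_converges p x x" "joint_moment_converges p y y"
  obtains P where "rv_cov_exists (measure_pmf P) fst snd"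
    and "rv_cov (measure_pmf P) fst snd = obs_cov p x y"
    and "measure_pmf.expectation P fst = obs_mean p x"
    and "measure_pmf.expectation P snd = obs_mean p y"
    and "(obs_cov p x y)\<^sup>2 \<le> obs_cov p x x * obs_cov p y y"
proof -
  obtain P where P: "\<And>s t. s \<noteq> 0 \<Longrightarrow> t \<noteq> 0 \<Longrightarrow> pmf P (s, t) = p (x {s}) (y {t})"
    "\<And>s. s \<noteq> 0 \<Longrightarrow> pmf (map_pmf fst P) s = s_state p (x {s})"
    "\<And>t. t \<noteq> 0 \<Longrightarrow> pmf (map_pmf snd P) t = s_state p (y {t})"
    by (rule s_map_joint_pmf_exists[OF p x y]) blast
  note [simp] = obs_mean_expectation[OF p x mean(1) P(2)] obs_mean_expectation[OF p y mean(2) P(3)]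
    joint_moment_expectation[OF p x y xy P(1)]
    second_moment_expectation[OF p x sq(1) P(2)] second_moment_expectation[OF p y sq(2) P(3)]
  have ex: "rv_cov_exists (measure_pmf P) fst snd" "rv_cov_exists (measure_pmf P) fst fst"
    "rv_cov_exists (measure_pmf P) snd snd"
    by (simp_all add: rv_cov_exists_def)
  note cov = ex[THEN rv_cov_eq[OF measure_pmf.prob_space_axioms]]
  have eq: "rv_cov (measure_pmf P) fst snd = obs_cov p x y"
    "rv_cov (measure_pmf P) fst fst = obs_cov p x x"
    "rv_cov (measure_pmf P) snd snd = obs_cov p y y"
    by (simp_all add: cov obs_cov_def)
  show thesis
    using rv_cov_Cauchy_Schwarz[OF measure_pmf.prob_space_axioms ex]
    by (intro that[of P] ex eq) (simp_all add: eq)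
qed

theorem proposition2p4:
  fixes p :: "'a::sigma_quantum_logic \<Rightarrow> 'a \<Rightarrow> real"
    and x y :: "real set \<Rightarrow> 'a"
  assumes "s_map p"
    and "discrete_observable x" and "discrete_observable y"
    and "obs_mean_converges p x" and "obs_mean_converges p y"
    and "joint_moment_converges p x y" and "joint_moment_converges p y x"
    and "joint_moment_converges p x x" and "joint_moment_converges p y y"
  shows "\<exists>(M1 :: (real \<times> real) measure) (M2 :: (real \<times> real) measure) \<xi>1 \<eta>1 \<xi>2 \<eta>2.
      prob_space M1 \<and> prob_space M2 \<and>
      \<xi>1 \<in> borel_measurable M1 \<and> \<eta>1 \<in> borel_measurable M1 \<and>
      \<xi>2 \<in> borel_measurable M2 \<and> \<eta>2 \<in> borel_measurable M2 \<and>
      rv_cov_exists M1 \<xi>1 \<eta>1 \<and> rv_cov_exists M2 \<eta>2 \<xi>2 \<and>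
      (obs_cov p x y = rv_cov M1 \<xi>1 \<eta>1 \<and> obs_cov p y x = rv_cov M2 \<eta>2 \<xi>2) \<and>
      (integral\<^sup>L M1 \<xi>1 = obs_mean p x \<and> integral\<^sup>L M1 \<eta>1 = obs_mean p y \<and>
       integral\<^sup>L M2 \<xi>2 = obs_mean p x \<and> integral\<^sup>L M2 \<eta>2 = obs_mean p y) \<and>
      (obs_cov p x y)\<^sup>2 \<le> obs_cov p x x * obs_cov p y y"
proof -
  have x: "observable x" and y: "observable y"
    using assms(2,3) by (auto simp: discrete_observable_def)
  obtain P1 where P1: "rv_cov_exists (measure_pmf P1) fst snd"
    "rv_cov (measure_pmf P1) fst snd = obs_cov p x y"
    "measure_pmf.expectation P1 fst = obs_mean p x"
    "measure_pmf.expectation P1 snd = obs_mean p y"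
    "(obs_cov p x y)\<^sup>2 \<le> obs_cov p x x * obs_cov p y y"
    by (rule s_map_covariance_representation[OF assms(1) x y assms(4,5,6,8,9)])
  \<comment> \<open>Since \<open>p\<close> need not be symmetric, the reversed order requires its
    own distribution. Its first coordinate represents \<open>y\<close>, so \<open>\<xi>2\<close> is
    \<open>snd\<close> and \<open>\<eta>2\<close> is \<open>fst\<close>.\<close>
  obtain P2 where P2: "rv_cov_exists (measure_pmf P2) fst snd"
    "rv_cov (measure_pmf P2) fst snd = obs_cov p y x"
    "measure_pmf.expectation P2 fst = obs_mean p y"
    "measure_pmf.expectation P2 snd = obs_mean p x"
    "(obs_cov p y x)\<^sup>2 \<le> obs_cov p y y * obs_cov p x x"
    by (rule s_map_covariance_representation[OF assms(1) y x assms(5,4,7,9,8)])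
  show ?thesis
    by (rule exI[of _ "measure_pmf P1"], rule exI[of _ "measure_pmf P2"],
        rule exI[of _ fst], rule exI[of _ snd], rule exI[of _ snd], rule exI[of _ fst])
      (simp add: P1 P2 measure_pmf.prob_space_axioms)
qed

end
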